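(* Assume (i) each $f_i$ is convex and $L_i$-smooth, and (ii) $f$ is $\mu$-strongly convex. Let $T$ be the number of iterations, $1\le\beta<T$, $\alpha=(\beta/T)^{1/T}$, $\gamma_{\max}>0$, and run SGD, $w_{k+1}=w_k-\gamma_k\alpha_k\nabla f_{i_k}(w_k)$, for $k=1,\dots,T$ with $\alpha_k=\left(\frac\beta T\right)^{k/T}$ and $\gamma_k$ the largest step-size satisfying $\gamma_k\le\gamma_{\max}$ and $$f_{i_k}(w_k-\gamma_k\nabla f_{i_k}(w_k))\le f_{i_k}(w_k)-c\,\gamma_k\|\nabla f_{i_k}(w_k)\|^2\quad\text{with } c=\tfrac12 .$$ Then $$\mathbb{E}\|w_{T+1}-w^*\|^2\le\|w_1-w^*\|^2c_1\exp\left(-\frac{T}{\kappa'}\frac{\alpha}{\ln(T/\beta)}\right)+\frac{8\sigma^2c_1(\kappa')^2\gamma_{\max}}{e^2}\frac{(\ln(T/\beta))^2}{\alpha^2T}+\frac{2\sigma^2c_1\kappa'\ln(T/\beta)\,\gamma_{\mathrm{err}}}{e\,\alpha},$$ where $\gamma_{\mathrm{err}}:=\gamma_{\max}-\min\{\gamma_{\max},\frac1L\}$, $\kappa':=\max\left\{\frac L\mu,\frac1{\mu\gamma_{\max}}\right\}$ and $c_1=\exp\left(\frac1{\kappa'}\cdot\frac{2\beta}{\ln(T/\beta)}\right)$.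
   Context: $f:\mathbb{R}^d\to\mathbb{R}$ is $f(w)=\frac1n\sum_{i=1}^nf_i(w)$, where each $f_i:\mathbb{R}^d\to\mathbb{R}$ is differentiable and bounded below, with infimum $f_i^*$. $L_i$-smooth means $f_i(v)\le f_i(w)+\langle\nabla f_i(w),v-w\rangle+\frac{L_i}{2}\|v-w\|^2$ for all $v,w$. $f$ is $\mu$-strongly convex ($\mu>0$) if $f(v)\ge f(w)+\langle\nabla f(w),v-w\rangle+\frac\mu2\|v-w\|^2$ for all $v,w$. Set $L:=\max_iL_i$, let $w^*$ be the unique minimizer of $f$, and let $\sigma^2:=\mathbb{E}_i[f_i(w^* )-f_i^*]=\frac1n\sum_i(f_i(w^* )-f_i^* )$. In SGD, $w_1$ is a deterministic starting point and the indices $i_k$ are drawn independently and uniformly from $\{1,\dots,n\}$; $\mathbb{E}$ is over all these draws. Note that $\gamma_k$ depends on $w_k$ and on the sampled index $i_k$. *)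

theory Defs
  imports "HOL-Probability.Probability"
begin

definition gradient :: "('a::real_inner \<Rightarrow> real) \<Rightarrow> 'a \<Rightarrow> 'a" where
  "gradient f x = (THE D. GDERIV f x :> D)"

lemma GDERIV_gradient:
  fixes f :: "'a::euclidean_space \<Rightarrow> real"
  assumes "f differentiable (at x)"
  shows "GDERIV f x :> gradient f x"
proof -
  obtain f' where f': "(f has_derivative f') (at x)"
    using assms unfolding differentiable_def by blast
  then have lin: "linear f'"
    by (rule has_derivative_linear)
  define D where "D = (\<Sum>b\<in>Basis. f' b *\<^sub>R b)"
  have "f' h = h \<bullet> D" for h
  proof -
    have "f' h = f' (\<Sum>b\<in>Basis. (h \<bullet> b) *\<^sub>R b)"
      by (simp add: euclidean_representation)
    also have "\<dots> = (\<Sum>b\<in>Basis. (h \<bullet> b) * f' b)"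
      by (simp add: linear_sum[OF lin] linear_cmul[OF lin])
    also have "\<dots> = h \<bullet> D"
      by (simp add: D_def inner_sum_right mult.commute)
    finally show ?thesis .
  qed
  then have "f' = (\<lambda>h. h \<bullet> D)" by (rule ext)
  with f' have D: "GDERIV f x :> D"
    by (simp add: gderiv_def)
  have "E = D" if "GDERIV f x :> E" for E
  proof -
    have "(\<lambda>h. h \<bullet> E) = (\<lambda>h. h \<bullet> D)"
      using that D unfolding gderiv_def by (rule has_derivative_unique)
    then have "\<forall>h. h \<bullet> E = h \<bullet> D" by metis
    then show ?thesis by (metis vector_eq_ldot)
  qed
  with D show ?thesis
    unfolding gradient_def by (rule theI)
qed

definition L_smooth :: "real \<Rightarrow> ('a::real_inner \<Rightarrow> real) \<Rightarrow> bool" where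
  "L_smooth L f \<longleftrightarrow>
     (\<forall>v w. f v \<le> f w + gradient f w \<bullet> (v - w) + L / 2 * (norm (v - w))\<^sup>2)"

definition strongly_convex :: "real \<Rightarrow> ('a::real_inner \<Rightarrow> real) \<Rightarrow> bool" where
  "strongly_convex \<mu> f \<longleftrightarrow> 0 < \<mu> \<and>
     (\<forall>v w. f v \<ge> f w + gradient f w \<bullet> (v - w) + \<mu> / 2 * (norm (v - w))\<^sup>2)"

definition armijo :: "real \<Rightarrow> ('a::real_inner \<Rightarrow> real) \<Rightarrow> 'a \<Rightarrow> real \<Rightarrow> bool" where
  "armijo c f w \<gamma> \<longleftrightarrow>
     f (w - \<gamma> *\<^sub>R gradient f w) \<le> f w - c * \<gamma> * (norm (gradient f w))\<^sup>2"

definition largest_armijo_step ::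
    "real \<Rightarrow> real \<Rightarrow> ('a::real_inner \<Rightarrow> real) \<Rightarrow> 'a \<Rightarrow> real \<Rightarrow> bool" where
  "largest_armijo_step c \<gamma>max f w \<gamma> \<longleftrightarrow>
     0 < \<gamma> \<and> \<gamma> \<le> \<gamma>max \<and> armijo c f w \<gamma> \<and>
     (\<forall>\<eta>. 0 < \<eta> \<and> \<eta> \<le> \<gamma>max \<and> armijo c f w \<eta> \<longrightarrow> \<eta> \<le> \<gamma>)"

end

theory Submission
  imports Defs
begin

text \<open>
  With constant \<open>1/2\<close>, the largest Armijo step \<open>\<gamma>\<close> at \<open>x\<close> for a convex \<open>L\<close>-smooth \<open>f\<close> satisfies
  \<open>\<gamma> \<ge> m\<close>, where \<open>m = min \<gamma>max (1/L)\<close> (\<open>largest_armijo_step_ge\<close>), and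
  \<open>\<gamma> * (norm (gradient f x))\<^sup>2 \<le> 2 * (f x - inf f)\<close> (\<open>armijo_gradient_bound\<close>).
  Expand the squared distance to the minimizer \<open>z\<close> after a step of length \<open>\<gamma> * a\<close>.
  The second bound absorbs the quadratic term into function values, up to the
  interpolation gap \<open>f z - inf f\<close>. The remaining term is \<open>- 2 * \<gamma> * a\<close> times a quantity that can be
  negative for a single sample, and \<open>\<gamma>\<close> is correlated with the sample, so strong convexity of the
  mean cannot be applied to it. Writing \<open>\<gamma> = m + (\<gamma> - m)\<close> resolves this: the excess
  \<open>\<gamma> - m\<close> is paid for by another multiple of the interpolation gap, and the coefficient that is
  left is deterministic (\<open>armijo_step_distance\<close>).

  The iterate \<open>w k\<close> is a function of the indices drawn before \<open>k\<close>, because the largest step is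
  unique, and those indices take finitely many values. Hence the new index may be averaged out
  with the iterate held fixed (\<open>expectation_fresh_uniform_index\<close>). After averaging, strong
  convexity gives \<open>\<mu> / 2 * (norm (x - z))\<^sup>2\<close> (\<open>average_descent\<close>), and since \<open>m * \<mu> = 1 / \<kappa>'\<close>
  the expected squared distances \<open>e k\<close> satisfy
  \<open>e (k + 1) \<le> (1 - \<alpha> ^ k / \<kappa>') * e k + (p * (\<alpha> ^ k)\<^sup>2 + q * \<alpha> ^ k)\<close>
  with \<open>p = 2 * \<gamma>max * \<sigma>2\<close> and \<open>q = 2 * \<gamma>err * \<sigma>2\<close>.

  Unrolling this with \<open>1 - t \<le> exp (- t)\<close> turns the products into exponentials of tails of a
  geometric series, and a tail starting after \<open>k\<close> is at least \<open>\<alpha> ^ (k + 1) / ln (1 / \<alpha>)\<close> up to a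
  constant that becomes \<open>c1\<close>. In the noise terms the exponential decay is traded for powers,
  \<open>exp (- y) \<le> 1 / (exp 1 * y)\<close> and its squared form, chosen so that the powers of \<open>\<alpha> ^ k\<close> cancel:
  every one of the \<open>T\<close> summands then has the same bound (\<open>exponential_schedule_sums\<close>).
\<close>

section \<open>Gradients\<close>

lemma gradient_eqI:
  fixes f :: "'a::euclidean_space \<Rightarrow> real"
  assumes "GDERIV f x :> D"
  shows "gradient f x = D"
proof -
  have "GDERIV f x :> gradient f x"
    using assms by (intro GDERIV_gradient) (auto simp: gderiv_def differentiable_def)
  then have "(\<lambda>h. h \<bullet> gradient f x) = (\<lambda>h. h \<bullet> D)"
    using assms unfolding gderiv_def by (rule has_derivative_unique)
  then show ?thesis by (metis vector_eq_ldot)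
qed

lemma gradient_average:
  fixes f :: "'i \<Rightarrow> 'a::euclidean_space \<Rightarrow> real"
  assumes "\<And>i. i \<in> A \<Longrightarrow> f i differentiable (at x)"
  shows "gradient (\<lambda>y. (\<Sum>i\<in>A. f i y) / c) x \<bullet> h = (\<Sum>i\<in>A. gradient (f i) x \<bullet> h) / c"
proof -
  have "((\<lambda>y. (\<Sum>i\<in>A. f i y) / c) has_derivative (\<lambda>h. (\<Sum>i\<in>A. h \<bullet> gradient (f i) x) / c)) (at x)"
    using GDERIV_gradient[OF assms] unfolding gderiv_def divide_inverse
    by (intro has_derivative_mult_left has_derivative_sum)
  then have "GDERIV (\<lambda>y. (\<Sum>i\<in>A. f i y) / c) x :> (1 / c) *\<^sub>R (\<Sum>i\<in>A. gradient (f i) x)"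
    unfolding gderiv_def by (simp add: inner_sum_right)
  from gradient_eqI[OF this] show ?thesis by (simp add: inner_sum_left)
qed

text \<open>
  Restricting \<open>f\<close> to the line through \<open>x\<close> and \<open>y\<close> reduces this to the tangent inequality for
  convex functions of a real variable.
\<close>

lemma convex_ge_gradient_plane:
  fixes f :: "'a::euclidean_space \<Rightarrow> real"
  assumes cvx: "convex_on UNIV f" and diff: "f differentiable (at x)"
  shows "f y \<ge> f x + gradient f x \<bullet> (y - x)"
proof -
  define h where "h t = f (x + t *\<^sub>R (y - x))" for t
  have "convex_on UNIV h"
  proof (rule convex_onI)
    fix t a b :: real assume t: "0 < t" "t < 1"
    have "x + ((1 - t) *\<^sub>R a + t *\<^sub>R b) *\<^sub>R (y - x)
        = (1 - t) *\<^sub>R (x + a *\<^sub>R (y - x)) + t *\<^sub>R (x + b *\<^sub>R (y - x))"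
      by (simp add: algebra_simps)
    then show "h ((1 - t) *\<^sub>R a + t *\<^sub>R b) \<le> (1 - t) * h a + t * h b"
      using convex_onD[OF cvx, of t "x + a *\<^sub>R (y - x)" "x + b *\<^sub>R (y - x)"] t
      unfolding h_def by (simp only: UNIV_I)
  qed simp
  moreover have "(h has_real_derivative gradient f x \<bullet> (y - x)) (at 0)"
  proof -
    have "(f has_derivative (\<lambda>v. v \<bullet> gradient f x)) (at (x + 0 *\<^sub>R (y - x)))"
      using GDERIV_gradient[OF diff] by (simp add: gderiv_def)
    moreover have "((\<lambda>t. x + t *\<^sub>R (y - x)) has_derivative (\<lambda>t. t *\<^sub>R (y - x))) (at 0)"
      by (auto intro!: derivative_eq_intros)
    ultimately have "((\<lambda>t. f (x + t *\<^sub>R (y - x))) has_derivative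
        (\<lambda>t. (t *\<^sub>R (y - x)) \<bullet> gradient f x)) (at 0)"
      by (rule has_derivative_compose[rotated])
    then show ?thesis
      unfolding h_def has_field_derivative_def
      by (rule has_derivative_eq_rhs) (auto simp: inner_commute)
  qed
  ultimately have "h 1 - h 0 \<ge> gradient f x \<bullet> (y - x) * (1 - 0)"
    by (intro convex_on_imp_above_tangent[of UNIV]) auto
  then show ?thesis by (simp add: h_def)
qed

section \<open>Armijo steps\<close>

lemma armijo_below_inverse_smoothness:
  assumes "L_smooth L f" "0 < L" "0 < \<eta>" "\<eta> \<le> 1 / L"
  shows "armijo (1 / 2) f x \<eta>"
proof -
  let ?g = "gradient f x"
  have "f (x - \<eta> *\<^sub>R ?g) \<le> f x - \<eta> * (norm ?g)\<^sup>2 + \<eta> * (\<eta> * L) * (norm ?g)\<^sup>2 / 2"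
    using assms(1)[unfolded L_smooth_def, rule_format, of "x - \<eta> *\<^sub>R ?g" x]
    by (simp add: power_mult_distrib dot_square_norm power2_eq_square mult_ac)
  also have "\<eta> * (\<eta> * L) * (norm ?g)\<^sup>2 / 2 \<le> \<eta> * 1 * (norm ?g)\<^sup>2 / 2"
    using assms by (intro divide_right_mono mult_right_mono mult_left_mono) (auto simp: field_simps)
  finally show ?thesis unfolding armijo_def by simp
qed

text \<open>
  The step \<open>min \<gamma>max (1 / L)\<close> is admissible and satisfies the Armijo condition, so it competes
  with the largest such step.
\<close>

lemma largest_armijo_step_ge:
  assumes "largest_armijo_step (1 / 2) \<gamma>max f x \<gamma>" "L_smooth L f" "0 < L"
  shows "min \<gamma>max (1 / L) \<le> \<gamma>"
proof -
  have "0 < min \<gamma>max (1 / L)"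
    using assms by (auto simp: largest_armijo_step_def)
  then show ?thesis
    using assms(1) armijo_below_inverse_smoothness[OF assms(2,3), of "min \<gamma>max (1 / L)" x]
    unfolding largest_armijo_step_def by simp
qed

lemma armijo_gradient_bound:
  assumes "armijo (1 / 2) f x \<gamma>" "bdd_below (range f)"
  shows "\<gamma> * (norm (gradient f x))\<^sup>2 \<le> 2 * (f x - (INF y. f y))"
proof -
  have "(INF y. f y) \<le> f (x - \<gamma> *\<^sub>R gradient f x)"
    using assms(2) by (intro cINF_lower) auto
  then show ?thesis using assms(1) unfolding armijo_def by simp
qed

text \<open>
  Uniqueness makes the step size a function of the iterate and the sampled index, so that no
  randomness enters an iteration other than that of the index.
\<close>

lemma largest_armijo_step_unique:
  assumes "largest_armijo_step c \<gamma>max f x \<gamma>" "largest_armijo_step c \<gamma>max f x \<gamma>'"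
  shows "\<gamma> = \<gamma>'"
  using assms unfolding largest_armijo_step_def by (meson order_antisym)

section \<open>Progress of a single iteration\<close>

text \<open>
  The right-hand side depends on the sampled function but not on the step size found by the line
  search, so it can be averaged over the samples. Nothing fixes the sign of the middle term for
  one sample; strong convexity controls it after averaging.
\<close>

lemma armijo_step_distance:
  fixes f :: "'a::euclidean_space \<Rightarrow> real"
  assumes diff: "f differentiable (at x)"
    and bdd: "bdd_below (range f)"
    and cvx: "convex_on UNIV f"
    and smooth: "L_smooth L f" "0 < L"
    and step: "largest_armijo_step (1 / 2) \<gamma>max f x \<gamma>"
    and a: "0 \<le> a" "a \<le> 1"
  defines "m \<equiv> min \<gamma>max (1 / L)"
  shows "(norm (x - (\<gamma> * a) *\<^sub>R gradient f x - z))\<^sup>2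
    \<le> (norm (x - z))\<^sup>2 - 2 * m * a * (gradient f x \<bullet> (x - z) - a * (f x - f z))
      + (2 * \<gamma>max * a\<^sup>2 + 2 * (\<gamma>max - m) * a) * (f z - (INF y. f y))"
proof -
  let ?g = "gradient f x"
  define A where "A = ?g \<bullet> (x - z)"
  define B where "B = f x - f z"
  define S where "S = f z - (INF y. f y)"
  have \<gamma>: "0 < \<gamma>" "\<gamma> \<le> \<gamma>max" "armijo (1 / 2) f x \<gamma>"
    using step by (auto simp: largest_armijo_step_def)
  have m: "m \<le> \<gamma>"
    unfolding m_def using largest_armijo_step_ge[OF step smooth] .
  have S: "0 \<le> S" and BS: "- S \<le> B"
    unfolding S_def B_def using bdd by (auto intro!: cINF_lower)
  have AB: "B \<le> A"
    using convex_ge_gradient_plane[OF cvx diff, of z]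
    by (simp add: A_def B_def inner_diff_right)
  have G: "\<gamma> * (norm ?g)\<^sup>2 \<le> 2 * (B + S)"
    using armijo_gradient_bound[OF \<gamma>(3) bdd] by (simp add: B_def S_def)
  \<comment> \<open>For a single sample the descent quantity may be negative, but by no more than its gap.\<close>
  have "- S \<le> - ((1 - a) * S)"
    using a S by (simp add: mult_left_le_one_le)
  also have "\<dots> \<le> (1 - a) * B"
    using mult_left_mono[OF BS, of "1 - a"] a by simp
  also have "\<dots> \<le> A - a * B"
    using AB by (simp add: algebra_simps)
  finally have gap: "- S \<le> A - a * B" .
  have "(norm (x - (\<gamma> * a) *\<^sub>R ?g - z))\<^sup>2 = (norm ((x - z) - (\<gamma> * a) *\<^sub>R ?g))\<^sup>2"
    by (simp add: algebra_simps)
  also have "\<dots> = (norm (x - z))\<^sup>2 - 2 * \<gamma> * a * A + \<gamma> * a\<^sup>2 * (\<gamma> * (norm ?g)\<^sup>2)"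
    unfolding A_def power2_norm_eq_inner
    by (simp add: inner_diff_left inner_diff_right inner_commute power2_eq_square algebra_simps)
  also have "\<dots> \<le> (norm (x - z))\<^sup>2 - 2 * \<gamma> * a * A + \<gamma> * a\<^sup>2 * (2 * (B + S))"
    using G \<gamma> by (intro add_left_mono mult_left_mono) auto
  \<comment> \<open>Split \<open>\<gamma> = m + (\<gamma> - m)\<close> to isolate the deterministic part of the step.\<close>
  also have "\<dots> = (norm (x - z))\<^sup>2 - 2 * m * a * (A - a * B)
      + 2 * a * ((\<gamma> - m) * - (A - a * B)) + 2 * a\<^sup>2 * (\<gamma> * S)"
    by (simp add: algebra_simps power2_eq_square)
  also have "\<dots> \<le> (norm (x - z))\<^sup>2 - 2 * m * a * (A - a * B)
      + 2 * a * ((\<gamma>max - m) * S) + 2 * a\<^sup>2 * (\<gamma>max * S)"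
  proof -
    have "(\<gamma> - m) * - (A - a * B) \<le> (\<gamma> - m) * S"
      using gap m by (intro mult_left_mono) auto
    also have "\<dots> \<le> (\<gamma>max - m) * S"
      using \<gamma> S by (intro mult_right_mono) auto
    finally show ?thesis
      using a \<gamma> S by (intro add_mono order_refl mult_left_mono mult_right_mono) auto
  qed
  finally show ?thesis
    by (simp add: A_def B_def S_def algebra_simps)
qed

text \<open>
  Strong convexity bounds the averaged inner product below by \<open>F x - F z\<close> plus the quadratic
  term; as \<open>z\<close> minimizes \<open>F\<close>, subtracting only the fraction \<open>a\<close> of \<open>F x - F z\<close> loses nothing.
\<close>

lemma average_descent:
  fixes f :: "'i \<Rightarrow> 'a::euclidean_space \<Rightarrow> real" and A :: "'i set" and N :: real
  defines "F \<equiv> (\<lambda>x. (\<Sum>i\<in>A. f i x) / N)"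
  assumes diff: "\<And>i. i \<in> A \<Longrightarrow> f i differentiable (at x)"
    and strong: "strongly_convex \<mu> F"
    and min: "is_arg_min F (\<lambda>_. True) z"
    and a: "a \<le> 1"
  shows "\<mu> / 2 * (norm (x - z))\<^sup>2
    \<le> (\<Sum>i\<in>A. gradient (f i) x \<bullet> (x - z) - a * (f i x - f i z)) / N"
proof -
  have "F z \<ge> F x + gradient F x \<bullet> (z - x) + \<mu> / 2 * (norm (z - x))\<^sup>2"
    using strong unfolding strongly_convex_def by blast
  moreover have "gradient F x \<bullet> (z - x) = - (gradient F x \<bullet> (x - z))"
    by (simp add: inner_diff_right)
  ultimately have "\<mu> / 2 * (norm (x - z))\<^sup>2 \<le> gradient F x \<bullet> (x - z) - 1 * (F x - F z)"
    by (simp add: norm_minus_commute)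
  also have "\<dots> \<le> gradient F x \<bullet> (x - z) - a * (F x - F z)"
    using min a by (intro diff_left_mono mult_right_mono) (auto simp: is_arg_min_linorder)
  also have "gradient F x \<bullet> (x - z) - a * (F x - F z)
      = (\<Sum>i\<in>A. gradient (f i) x \<bullet> (x - z) - a * (f i x - f i z)) / N"
    using gradient_average[of A f x N "x - z"] diff unfolding F_def
    by (simp add: sum_subtractf diff_divide_distrib right_diff_distrib sum_distrib_left)
  finally show ?thesis by simp
qed

text \<open>
  The mean is at once \<open>\<mu>\<close>-strongly convex and bounded above by a quadratic with coefficient \<open>L\<close>;
  comparing the two along a unit vector gives even \<open>\<mu> \<le> L\<close>.
\<close>

lemma smoothness_constant_pos:
  fixes f :: "'i \<Rightarrow> 'a::euclidean_space \<Rightarrow> real"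
  assumes A: "finite A" "A \<noteq> {}"
    and diff: "\<And>i x. i \<in> A \<Longrightarrow> f i differentiable (at x)"
    and smooth: "\<And>i. i \<in> A \<Longrightarrow> L_smooth L (f i)"
    and strong: "strongly_convex \<mu> (\<lambda>x. (\<Sum>i\<in>A. f i x) / real (card A))"
  shows "0 < L"
proof -
  let ?N = "real (card A)" and ?F = "\<lambda>x. (\<Sum>i\<in>A. f i x) / real (card A)"
  have N: "0 < ?N" using A by (simp add: card_gt_0_iff)
  obtain v :: 'a where v: "norm v = 1"
    using vector_choose_size[of 1] by auto
  have "?F 0 + gradient ?F 0 \<bullet> (v - 0) + \<mu> / 2 * (norm (v - 0))\<^sup>2 \<le> ?F v"
    using strong unfolding strongly_convex_def by blast
  then have "\<mu> / 2 * (norm v)\<^sup>2 \<le> ?F v - ?F 0 - gradient ?F 0 \<bullet> v"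
    unfolding diff_zero by linarith
  also have "\<dots> = (\<Sum>i\<in>A. f i v - f i 0 - gradient (f i) 0 \<bullet> v) / ?N"
    using gradient_average[of A f 0 ?N v] diff by (simp add: sum_subtractf diff_divide_distrib)
  also have "\<dots> \<le> (\<Sum>i\<in>A. L / 2 * (norm v)\<^sup>2) / ?N"
  proof (intro divide_right_mono sum_mono)
    fix i assume "i \<in> A"
    then show "f i v - f i 0 - gradient (f i) 0 \<bullet> v \<le> L / 2 * (norm v)\<^sup>2"
      using smooth[unfolded L_smooth_def, rule_format, of i v 0] by simp
  qed (use N in auto)
  also have "\<dots> = L / 2 * (norm v)\<^sup>2" using N by simp
  finally show ?thesis using v strong by (simp add: strongly_convex_def)
qed

lemma L_smooth_mono:
  assumes "L_smooth L f" "L \<le> L'"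
  shows "L_smooth L' f"
  unfolding L_smooth_def
proof (intro allI)
  fix v w
  have "f v \<le> f w + gradient f w \<bullet> (v - w) + L / 2 * (norm (v - w))\<^sup>2"
    using assms(1) unfolding L_smooth_def by blast
  also have "L / 2 * (norm (v - w))\<^sup>2 \<le> L' / 2 * (norm (v - w))\<^sup>2"
    using assms(2) by (intro mult_right_mono divide_right_mono) auto
  finally show "f v \<le> f w + gradient f w \<bullet> (v - w) + L' / 2 * (norm (v - w))\<^sup>2" by simp
qed

section \<open>Averaging over a freshly drawn index\<close>

text \<open>
  Finitely many variables with finitely many values jointly take finitely many values. Hence any
  function of them is measurable and bounded, whatever the regularity of \<open>\<phi>\<close>; in the application
  \<open>\<phi>\<close> involves line searches.
\<close>

lemma (in prob_space) integrable_of_finite_family: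
  fixes \<phi> :: "('j \<Rightarrow> 'i) \<Rightarrow> real"
  assumes fin: "finite J" "finite A"
    and rv: "\<And>j. j \<in> J \<Longrightarrow> random_variable (count_space A) (X j)"
  shows "integrable M (\<lambda>\<omega>. \<phi> (restrict (\<lambda>j. X j \<omega>) J))"
proof -
  let ?X = "\<lambda>\<omega>. restrict (\<lambda>j. X j \<omega>) J"
  have "?X \<in> measurable M (PiM J (\<lambda>_. count_space A))"
    using rv by (intro measurable_restrict) auto
  then have X: "?X \<in> measurable M (count_space (PiE J (\<lambda>_. A)))"
    using fin by (subst (asm) count_space_PiM_finite) (auto simp: countable_finite)
  then have "(\<lambda>\<omega>. \<phi> (?X \<omega>)) \<in> borel_measurable M"
    by (rule measurable_compose) simp
  moreover have "finite (PiE J (\<lambda>_. A))"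
    using fin by (auto intro: finite_PiE)
  then have "norm (\<phi> (?X \<omega>)) \<le> (\<Sum>s\<in>PiE J (\<lambda>_. A). norm (\<phi> s))" if "\<omega> \<in> space M" for \<omega>
    using measurable_space[OF X that]
    by (intro member_le_sum[where f = "\<lambda>s. norm (\<phi> s)"]) auto
  ultimately show ?thesis
    by (intro integrable_const_bound[where B = "\<Sum>s\<in>PiE J (\<lambda>_. A). norm (\<phi> s)"]) auto
qed

text \<open>
  Decompose according to the value \<open>i\<close> of the fresh index: on that event \<open>H (X k) Y\<close> equals
  \<open>H i Y\<close>, the event is independent of \<open>Y\<close>, and its probability is \<open>1 / card A\<close>.
\<close>

lemma (in prob_space) expectation_fresh_uniform_index:
  fixes H :: "'i \<Rightarrow> 'c \<Rightarrow> real"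
  assumes indep: "indep_vars (\<lambda>_. count_space A) X I"
    and A: "finite A"
    and J: "finite J" "J \<subseteq> I"
    and k: "k \<in> I" "k \<notin> J"
    and uniform: "distr M (count_space A) (X k) = uniform_count_measure A"
    and Y: "\<And>\<omega>. \<omega> \<in> space M \<Longrightarrow> Y \<omega> = g (restrict (\<lambda>j. X j \<omega>) J)"
  shows "integrable M (\<lambda>\<omega>. H (X k \<omega>) (Y \<omega>))"
    and "expectation (\<lambda>\<omega>. H (X k \<omega>) (Y \<omega>))
      = expectation (\<lambda>\<omega>. (\<Sum>i\<in>A. H i (Y \<omega>)) / real (card A))"
proof -
  have rv: "\<And>j. j \<in> I \<Longrightarrow> random_variable (count_space A) (X j)"
    using indep by (auto simp: indep_vars_def)
  note Xk[measurable] = rv[OF k(1)]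
  let ?XJ = "\<lambda>\<omega>. restrict (\<lambda>j. X j \<omega>) J" and ?Xk = "\<lambda>\<omega>. restrict (\<lambda>j. X j \<omega>) {k}"
  let ?ind = "\<lambda>i \<omega>. indicator {i} (X k \<omega>) :: real"
  have PiM: "PiM K (\<lambda>_. count_space A) = count_space (PiE K (\<lambda>_. A))" if "finite K" for K :: "'b set"
    using that A by (intro count_space_PiM_finite) (auto simp: countable_finite)
  have "indep_var (PiM {k} (\<lambda>_. count_space A)) ?Xk (PiM J (\<lambda>_. count_space A)) ?XJ"
    using J k by (intro indep_var_restrict[OF indep]) auto
  then have ind: "indep_var (count_space (PiE {k} (\<lambda>_. A))) ?Xk (count_space (PiE J (\<lambda>_. A))) ?XJ"
    using J by (simp add: PiM)
  have int_ind: "integrable M (?ind i)" for i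
    by (intro integrable_const_bound[where B = 1]) (auto simp: indicator_def)
  have int_Y: "integrable M (\<lambda>\<omega>. H i (g (?XJ \<omega>)))" for i
    using J A rv by (intro integrable_of_finite_family[where \<phi> = "\<lambda>s. H i (g s)"]) auto
  have ind_i: "indep_var borel (?ind i) borel (\<lambda>\<omega>. H i (g (?XJ \<omega>)))" for i
    using indep_var_compose[OF ind, of "\<lambda>s. indicator {i} (s k)" borel "\<lambda>s. H i (g s)" borel]
    by (simp add: comp_def)
  have prob: "expectation (?ind i) = 1 / real (card A)" if "i \<in> A" for i
  proof -
    have "expectation (?ind i) = measure (distr M (count_space A) (X k)) {i}"
      using that by (subst integral_distr[symmetric, where N = "count_space A" and f = "indicator {i}"]) auto
    also have "\<dots> = 1 / real (card A)"
      unfolding uniform using that A by (simp add: measure_uniform_count_measure)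
    finally show ?thesis .
  qed
  have split: "H (X k \<omega>) (Y \<omega>) = (\<Sum>i\<in>A. ?ind i \<omega> * H i (g (?XJ \<omega>)))" if "\<omega> \<in> space M" for \<omega>
    using measurable_space[OF Xk that] Y[OF that] A
    by (simp add: indicator_def if_distrib[of "\<lambda>t. t * _"] sum.delta cong: if_cong)
  have int: "integrable M (\<lambda>\<omega>. \<Sum>i\<in>A. ?ind i \<omega> * H i (g (?XJ \<omega>)))"
    by (intro Bochner_Integration.integrable_sum indep_var_integrable ind_i int_ind int_Y)
  show "integrable M (\<lambda>\<omega>. H (X k \<omega>) (Y \<omega>))"
    using int by (subst Bochner_Integration.integrable_cong[OF refl split]) auto
  have "expectation (\<lambda>\<omega>. H (X k \<omega>) (Y \<omega>)) = expectation (\<lambda>\<omega>. \<Sum>i\<in>A. ?ind i \<omega> * H i (g (?XJ \<omega>)))"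
    using split by (intro Bochner_Integration.integral_cong) auto
  also have "\<dots> = (\<Sum>i\<in>A. expectation (?ind i) * expectation (\<lambda>\<omega>. H i (g (?XJ \<omega>))))"
    by (subst Bochner_Integration.integral_sum)
      (auto intro!: indep_var_integrable ind_i int_ind int_Y sum.cong indep_var_lebesgue_integral)
  also have "\<dots> = (\<Sum>i\<in>A. expectation (\<lambda>\<omega>. H i (g (?XJ \<omega>)))) / real (card A)"
    by (simp add: prob sum_divide_distrib)
  also have "\<dots> = expectation (\<lambda>\<omega>. (\<Sum>i\<in>A. H i (g (?XJ \<omega>))) / real (card A))"
    using int_Y by (simp add: Bochner_Integration.integral_sum)
  also have "\<dots> = expectation (\<lambda>\<omega>. (\<Sum>i\<in>A. H i (Y \<omega>)) / real (card A))"
    using Y by (intro Bochner_Integration.integral_cong) auto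
  finally show "expectation (\<lambda>\<omega>. H (X k \<omega>) (Y \<omega>))
      = expectation (\<lambda>\<omega>. (\<Sum>i\<in>A. H i (Y \<omega>)) / real (card A))" .
qed

text \<open>
  A process driven by the inputs \<open>X 1, X 2, \<dots>\<close> depends at time \<open>k\<close> on the inputs before \<open>k\<close>
  alone, which is what makes it independent of the input at time \<open>k\<close>.
\<close>

lemma adapted_recursion:
  fixes T :: nat
  assumes init: "\<And>\<omega>. \<omega> \<in> \<Omega> \<Longrightarrow> Y 1 \<omega> = y1"
    and rec: "\<And>k \<omega>. k \<in> {1..T} \<Longrightarrow> \<omega> \<in> \<Omega> \<Longrightarrow> Y (k + 1) \<omega> = G k (X k \<omega>) (Y k \<omega>)"
    and k: "1 \<le> k" "k \<le> T + 1"
  shows "\<exists>g. \<forall>\<omega>\<in>\<Omega>. Y k \<omega> = g (restrict (\<lambda>j. X j \<omega>) {1..<k})"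
  using k
proof (induction k rule: dec_induct)
  case base
  show ?case using init by (intro exI[of _ "\<lambda>_. y1"]) auto
next
  case (step k)
  have "k \<le> T + 1" using step.prems by simp
  then obtain g where g: "\<forall>\<omega>\<in>\<Omega>. Y k \<omega> = g (restrict (\<lambda>j. X j \<omega>) {1..<k})"
    using step.IH by blast
  let ?g = "\<lambda>s. G k (s k) (g (restrict s {1..<k}))"
  have "Y (Suc k) \<omega> = ?g (restrict (\<lambda>j. X j \<omega>) {1..<Suc k})" if \<omega>: "\<omega> \<in> \<Omega>" for \<omega>
  proof -
    have "{1..<Suc k} \<inter> {1..<k} = {1..<k}" by auto
    then have past: "restrict (restrict (\<lambda>j. X j \<omega>) {1..<Suc k}) {1..<k} = restrict (\<lambda>j. X j \<omega>) {1..<k}"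
      by (simp only: restrict_restrict)
    have "Y (Suc k) \<omega> = G k (X k \<omega>) (Y k \<omega>)"
      using rec[of k \<omega>] \<omega> step.hyps step.prems by simp
    also have "Y k \<omega> = g (restrict (\<lambda>j. X j \<omega>) {1..<k})"
      using g \<omega> by blast
    finally show ?thesis
      unfolding past using step.hyps by simp
  qed
  then show ?case by (intro exI[of _ ?g] ballI)
qed

section \<open>Unrolling the recurrence for an exponential schedule\<close>

text \<open>
  As \<open>e\<close> is nonnegative, each factor \<open>1 - a k\<close> may be replaced by \<open>exp (- a k)\<close>, even where it is
  negative; the products of the factors become exponentials of sums.
\<close>

lemma unroll_contraction:
  fixes e a b :: "nat \<Rightarrow> real"
  assumes rec: "\<And>k. k \<in> {1..T} \<Longrightarrow> e (k + 1) \<le> (1 - a k) * e k + b k"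
    and nonneg: "\<And>k. 0 \<le> e k"
  shows "e (T + 1) \<le> e 1 * exp (- (\<Sum>i=1..T. a i)) + (\<Sum>k=1..T. b k * exp (- (\<Sum>i=k+1..T. a i)))"
  using rec
proof (induction T)
  case (Suc T)
  have "e (Suc T + 1) \<le> (1 - a (Suc T)) * e (Suc T) + b (Suc T)"
    using Suc.prems[of "Suc T"] by simp
  also have "(1 - a (Suc T)) * e (Suc T) \<le> exp (- a (Suc T)) * e (Suc T)"
    using nonneg exp_ge_add_one_self[of "- a (Suc T)"] by (intro mult_right_mono) auto
  also have "e (Suc T) \<le> e 1 * exp (- (\<Sum>i=1..T. a i)) + (\<Sum>k=1..T. b k * exp (- (\<Sum>i=k+1..T. a i)))"
    using Suc.IH Suc.prems by auto
  also have "exp (- a (Suc T)) * (e 1 * exp (- (\<Sum>i=1..T. a i)) + (\<Sum>k=1..T. b k * exp (- (\<Sum>i=k+1..T. a i)))) + b (Suc T)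
     = e 1 * exp (- (\<Sum>i=1..Suc T. a i)) + (\<Sum>k=1..Suc T. b k * exp (- (\<Sum>i=k+1..Suc T. a i)))"
  proof -
    have "exp (- a (Suc T)) * exp (- (\<Sum>i=k..T. a i)) = exp (- (\<Sum>i=k..Suc T. a i))" if "k \<le> Suc T" for k
      using that by (simp flip: exp_add)
    then show ?thesis
      by (simp add: distrib_left sum_distrib_left mult.left_commute del: sum.cl_ivl_Suc add: sum.nat_ivl_Suc')
  qed
  finally show ?case by simp
qed simp

text \<open>
  The closed form of the sum is a difference of two terms, which call for opposite bounds:
  \<open>1 - a \<le> ln (1 / a)\<close> for the leading one and \<open>ln (1 / a) \<le> 1 / a - 1\<close> for the subtracted one.
\<close>

lemma geometric_tail_ge:
  fixes a :: real
  assumes a: "0 < a" "a < 1" and k: "k \<le> m"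
  shows "a ^ (k + 1) / ln (1 / a) - a ^ m / ln (1 / a) \<le> (\<Sum>i=k+1..m. a ^ i)"
proof -
  have l: "0 < ln (1 / a)" using a by simp
  have "(1 - a) * (\<Sum>i=k+1..m. a ^ i) = a ^ (k + 1) - a ^ (m + 1)"
    using k
  proof (induction m rule: dec_induct)
    case (step r)
    have "(1 - a) * (\<Sum>i=k+1..Suc r. a ^ i) = (1 - a) * (\<Sum>i=k+1..r. a ^ i) + (1 - a) * a ^ Suc r"
      using step.hyps by (simp flip: distrib_left)
    also have "\<dots> = a ^ (k + 1) - a ^ (Suc r + 1)"
      unfolding step.IH by (simp add: algebra_simps)
    finally show ?case .
  qed simp
  then have "(\<Sum>i=k+1..m. a ^ i) = (a ^ (k + 1) - a ^ (m + 1)) / (1 - a)"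
    using a by (simp add: eq_divide_eq mult.commute)
  then have sum: "(\<Sum>i=k+1..m. a ^ i) = a ^ (k + 1) / (1 - a) - a ^ m * (a / (1 - a))"
    by (simp add: diff_divide_distrib mult.commute)
  have up: "1 - a \<le> ln (1 / a)"
    using ln_le_minus_one[of a] a by (simp add: ln_div)
  have lo: "ln (1 / a) \<le> 1 / a - 1"
    using ln_le_minus_one[of "1 / a"] a by simp
  have "a ^ (k + 1) / ln (1 / a) \<le> a ^ (k + 1) / (1 - a)"
    using a up l by (intro divide_left_mono) auto
  moreover have "a / (1 - a) \<le> 1 / ln (1 / a)"
    using lo a l by (simp add: field_simps)
  then have "a ^ m * (a / (1 - a)) \<le> a ^ m * (1 / ln (1 / a))"
    using a by (intro mult_left_mono) auto
  ultimately show ?thesis using sum by simp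
qed

lemma exp_minus_le_inverse:
  fixes y :: real
  assumes "0 < y"
  shows "exp (- y) \<le> 1 / (exp 1 * y)"
proof -
  have "y \<le> exp (y - 1)" using exp_ge_add_one_self[of "y - 1"] by simp
  then show ?thesis using assms by (simp add: exp_diff exp_minus field_simps)
qed

lemma exp_minus_le_inverse_square:
  fixes y :: real
  assumes "0 < y"
  shows "exp (- y) \<le> 4 / ((exp 1)\<^sup>2 * y\<^sup>2)"
proof -
  have "exp (- y) = (exp (- (y / 2)))\<^sup>2" by (simp flip: exp_double)
  also have "\<dots> \<le> (1 / (exp 1 * (y / 2)))\<^sup>2"
    using assms by (intro power_mono exp_minus_le_inverse) auto
  finally show ?thesis by (simp add: power_mult_distrib power_divide)
qed

text \<open>
  The base \<open>\<alpha>\<close> satisfies \<open>\<alpha> ^ T = \<beta> / T\<close> and \<open>ln (1 / \<alpha>) = \<Lambda> / T\<close>, so the end of the geometric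
  series adds at most \<open>\<beta> / (\<kappa> * \<Lambda>)\<close> to the exponents, half of what \<open>c\<close> allows. The
  remaining exponent for index \<open>k\<close> is \<open>y = \<alpha> ^ (k + 1) * T / (\<kappa> * \<Lambda>)\<close>. Bounding \<open>exp (- y)\<close> by
  a multiple of \<open>1 / y\<^sup>2\<close> next to \<open>(\<alpha> ^ k)\<^sup>2\<close>, and of \<open>1 / y\<close> next to \<open>\<alpha> ^ k\<close>, makes the
  summands independent of \<open>k\<close>.
\<close>

lemma exponential_schedule_sums:
  fixes \<beta> \<kappa> p q :: real and T :: nat
  assumes \<beta>: "0 < \<beta>" "\<beta> < real T" and \<kappa>: "0 < \<kappa>" and pq: "0 \<le> p" "0 \<le> q"
  defines "\<alpha> \<equiv> (\<beta> / real T) powr (1 / real T)"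
    and "\<Lambda> \<equiv> ln (real T / \<beta>)"
    and "c \<equiv> exp (1 / \<kappa> * (2 * \<beta> / ln (real T / \<beta>)))"
  shows "exp (- (\<Sum>i=1..T. \<alpha> ^ i / \<kappa>)) \<le> c * exp (- (real T / \<kappa>) * (\<alpha> / \<Lambda>))"
    and "(\<Sum>k=1..T. (p * (\<alpha> ^ k)\<^sup>2 + q * \<alpha> ^ k) * exp (- (\<Sum>i=k+1..T. \<alpha> ^ i / \<kappa>)))
      \<le> 4 * p * c * \<kappa>\<^sup>2 / (exp 1)\<^sup>2 * (\<Lambda>\<^sup>2 / (\<alpha>\<^sup>2 * real T)) + q * c * \<kappa> * \<Lambda> / (exp 1 * \<alpha>)"
proof -
  have T: "0 < real T" using \<beta> by simp
  have \<Lambda>: "0 < \<Lambda>" unfolding \<Lambda>_def using \<beta> by (intro ln_gt_zero) simp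
  have \<alpha>0: "0 < \<alpha>" unfolding \<alpha>_def using \<beta> T by simp
  have ln\<alpha>: "ln (1 / \<alpha>) = \<Lambda> / real T"
    using \<beta> T unfolding \<alpha>_def \<Lambda>_def by (simp add: ln_div ln_powr field_simps)
  have "0 < ln (1 / \<alpha>)" using \<Lambda> T by (simp add: ln\<alpha>)
  then have \<alpha>1: "\<alpha> < 1" using \<alpha>0 by (simp add: ln_div)
  have \<alpha>T: "\<alpha> ^ T = \<beta> / real T"
    using \<beta> T unfolding \<alpha>_def by (simp add: powr_power)
  have tail: "exp (- (\<Sum>i=k+1..T. \<alpha> ^ i / \<kappa>)) \<le> c * exp (- (\<alpha> ^ (k + 1) * real T / (\<kappa> * \<Lambda>)))"
    if "k \<le> T" for k
  proof -
    have "- (\<Sum>i=k+1..T. \<alpha> ^ i / \<kappa>) = - (\<Sum>i=k+1..T. \<alpha> ^ i) / \<kappa>"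
      by (simp add: sum_divide_distrib)
    also have "\<dots> \<le> - (\<alpha> ^ (k + 1) / ln (1 / \<alpha>) - \<alpha> ^ T / ln (1 / \<alpha>)) / \<kappa>"
      using geometric_tail_ge[OF \<alpha>0 \<alpha>1 that] \<kappa> by (intro divide_right_mono) auto
    also have "\<dots> = 1 / \<kappa> * (\<beta> / \<Lambda>) - \<alpha> ^ (k + 1) * real T / (\<kappa> * \<Lambda>)"
      unfolding ln\<alpha> \<alpha>T using \<kappa> \<Lambda> T by (simp add: field_simps)
    also have "\<dots> \<le> 1 / \<kappa> * (2 * \<beta> / \<Lambda>) - \<alpha> ^ (k + 1) * real T / (\<kappa> * \<Lambda>)"
      using \<kappa> \<Lambda> \<beta> by (intro diff_right_mono mult_left_mono divide_right_mono) auto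
    finally show ?thesis by (simp add: c_def \<Lambda>_def flip: exp_add)
  qed
  show "exp (- (\<Sum>i=1..T. \<alpha> ^ i / \<kappa>)) \<le> c * exp (- (real T / \<kappa>) * (\<alpha> / \<Lambda>))"
    using tail[of 0] by (simp add: mult_ac)
  have c: "0 < c" by (simp add: c_def)
  have each: "(p * (\<alpha> ^ k)\<^sup>2 + q * \<alpha> ^ k) * exp (- (\<Sum>i=k+1..T. \<alpha> ^ i / \<kappa>))
      \<le> (4 * p * c * \<kappa>\<^sup>2 / (exp 1)\<^sup>2 * (\<Lambda>\<^sup>2 / (\<alpha>\<^sup>2 * real T)) + q * c * \<kappa> * \<Lambda> / (exp 1 * \<alpha>)) / real T"
    if "k \<in> {1..T}" for k
  proof -
    define y where "y = \<alpha> ^ (k + 1) * real T / (\<kappa> * \<Lambda>)"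
    have y: "0 < y" unfolding y_def using \<alpha>0 T \<kappa> \<Lambda> by simp
    have "(p * (\<alpha> ^ k)\<^sup>2 + q * \<alpha> ^ k) * exp (- (\<Sum>i=k+1..T. \<alpha> ^ i / \<kappa>))
        \<le> (p * (\<alpha> ^ k)\<^sup>2 + q * \<alpha> ^ k) * (c * exp (- y))"
      using tail[of k] that pq \<alpha>0 unfolding y_def by (intro mult_left_mono) auto
    also have "\<dots> = p * (\<alpha> ^ k)\<^sup>2 * c * exp (- y) + q * \<alpha> ^ k * c * exp (- y)"
      by (simp add: algebra_simps)
    also have "\<dots> \<le> p * (\<alpha> ^ k)\<^sup>2 * c * (4 / ((exp 1)\<^sup>2 * y\<^sup>2)) + q * \<alpha> ^ k * c * (1 / (exp 1 * y))"
      using pq \<alpha>0 c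
      by (intro add_mono mult_left_mono exp_minus_le_inverse[OF y] exp_minus_le_inverse_square[OF y]) auto
    also have "p * (\<alpha> ^ k)\<^sup>2 * c * (4 / ((exp 1)\<^sup>2 * y\<^sup>2))
        = 4 * p * c * \<kappa>\<^sup>2 / (exp 1)\<^sup>2 * (\<Lambda>\<^sup>2 / (\<alpha>\<^sup>2 * real T)) / real T"
      unfolding y_def using \<alpha>0 T \<kappa> \<Lambda> by (simp add: field_simps power2_eq_square)
    also have "q * \<alpha> ^ k * c * (1 / (exp 1 * y)) = q * c * \<kappa> * \<Lambda> / (exp 1 * \<alpha>) / real T"
      unfolding y_def using \<alpha>0 T \<kappa> \<Lambda> by (simp add: field_simps)
    finally show ?thesis by (simp add: add_divide_distrib)
  qed
  show "(\<Sum>k=1..T. (p * (\<alpha> ^ k)\<^sup>2 + q * \<alpha> ^ k) * exp (- (\<Sum>i=k+1..T. \<alpha> ^ i / \<kappa>)))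
      \<le> 4 * p * c * \<kappa>\<^sup>2 / (exp 1)\<^sup>2 * (\<Lambda>\<^sup>2 / (\<alpha>\<^sup>2 * real T)) + q * c * \<kappa> * \<Lambda> / (exp 1 * \<alpha>)"
    using sum_bounded_above[OF each, of "{1..T}"] T by simp
qed

section \<open>Convergence of SGD with Armijo steps\<close>

theorem theorem2:
  fixes f :: "nat \<Rightarrow> real ^ 'd \<Rightarrow> real"
    and F :: "real ^ 'd \<Rightarrow> real"
    and n T :: nat
    and Ls :: "nat \<Rightarrow> real"
    and L \<mu> \<beta> \<alpha> \<gamma>max \<gamma>err \<kappa>' c1 \<sigma>2 :: real
    and M :: "'s measure"
    and idx :: "nat \<Rightarrow> 's \<Rightarrow> nat"
    and w :: "nat \<Rightarrow> 's \<Rightarrow> real ^ 'd"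
    and \<gamma> :: "nat \<Rightarrow> 's \<Rightarrow> real"
    and \<alpha>s :: "nat \<Rightarrow> real"
    and w1 wstar :: "real ^ 'd"
  defines "F \<equiv> (\<lambda>x. (\<Sum>i=1..n. f i x) / real n)"
    and "L \<equiv> Max (Ls ` {1..n})"
    and "\<alpha> \<equiv> (\<beta> / real T) powr (1 / real T)"
    and "\<alpha>s \<equiv> (\<lambda>k. (\<beta> / real T) powr (real k / real T))"
    and "\<sigma>2 \<equiv> (\<Sum>i=1..n. (f i wstar - (INF x. f i x))) / real n"
    and "\<gamma>err \<equiv> \<gamma>max - min \<gamma>max (1 / L)"
    and "\<kappa>' \<equiv> max (L / \<mu>) (1 / (\<mu> * \<gamma>max))"
    and "c1 \<equiv> exp (1 / \<kappa>' * (2 * \<beta> / ln (real T / \<beta>)))"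
  assumes n: "n \<ge> 1"
    and differentiable: "\<And>i x. i \<in> {1..n} \<Longrightarrow> f i differentiable (at x)"
    and bounded_below: "\<And>i. i \<in> {1..n} \<Longrightarrow> bdd_below (range (f i))"
    and convex: "\<And>i. i \<in> {1..n} \<Longrightarrow> convex_on UNIV (f i)"
    and smooth: "\<And>i. i \<in> {1..n} \<Longrightarrow> L_smooth (Ls i) (f i)"
    and strongly_convex: "strongly_convex \<mu> F"
    and minimizer: "is_arg_min F (\<lambda>_. True) wstar"
    and \<beta>: "1 \<le> \<beta>" "\<beta> < real T"
    and \<gamma>max: "\<gamma>max > 0"
    and M: "prob_space M"
    and indep: "prob_space.indep_vars M (\<lambda>_. count_space {1..n}) idx {1..T}"
    and uniform: "\<And>k. k \<in> {1..T} \<Longrightarrow>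
          distr M (count_space {1..n}) (idx k) = uniform_count_measure {1..n}"
    and start: "\<And>\<omega>. \<omega> \<in> space M \<Longrightarrow> w 1 \<omega> = w1"
    and step_size: "\<And>k \<omega>. k \<in> {1..T} \<Longrightarrow> \<omega> \<in> space M \<Longrightarrow>
          largest_armijo_step (1 / 2) \<gamma>max (f (idx k \<omega>)) (w k \<omega>) (\<gamma> k \<omega>)"
    and sgd: "\<And>k \<omega>. k \<in> {1..T} \<Longrightarrow> \<omega> \<in> space M \<Longrightarrow>
          w (k + 1) \<omega> = w k \<omega> - (\<gamma> k \<omega> * \<alpha>s k) *\<^sub>R gradient (f (idx k \<omega>)) (w k \<omega>)"
  shows "prob_space.expectation M (\<lambda>\<omega>. (norm (w (T + 1) \<omega> - wstar))\<^sup>2)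
     \<le> (norm (w1 - wstar))\<^sup>2 * c1 * exp (- (real T / \<kappa>') * (\<alpha> / ln (real T / \<beta>)))
       + 8 * \<sigma>2 * c1 * \<kappa>'\<^sup>2 * \<gamma>max / (exp 1)\<^sup>2 * ((ln (real T / \<beta>))\<^sup>2 / (\<alpha>\<^sup>2 * real T))
       + 2 * \<sigma>2 * c1 * \<kappa>' * ln (real T / \<beta>) * \<gamma>err / (exp 1 * \<alpha>)"
proof -
  interpret prob_space M by (rule M)
  define e where "e k = expectation (\<lambda>\<omega>. (norm (w k \<omega> - wstar))\<^sup>2)" for k
  define m where "m = min \<gamma>max (1 / L)"
  define s where "s i = f i wstar - (INF x. f i x)" for i
  define p where "p = 2 * \<gamma>max * \<sigma>2"
  define q where "q = 2 * \<gamma>err * \<sigma>2"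

  have T: "0 < real T" using \<beta> by simp
  have \<mu>: "0 < \<mu>" using strongly_convex by (simp add: strongly_convex_def)
  have smooth_L: "L_smooth L (f i)" if "i \<in> {1..n}" for i
    using that by (intro L_smooth_mono[OF smooth]) (auto simp: L_def)
  have L: "0 < L"
    using n strongly_convex
    by (intro smoothness_constant_pos[of "{1..n}" f L \<mu>] differentiable smooth_L) (auto simp: F_def)
  \<comment> \<open>The smaller of \<open>\<gamma>max\<close> and \<open>1 / L\<close> decides both the minimum \<open>m\<close> and the maximum \<open>\<kappa>'\<close>.\<close>
  have contraction: "m * \<mu> = 1 / \<kappa>'"
  proof (cases "\<gamma>max \<le> 1 / L")
    case True
    then have "L / \<mu> \<le> 1 / (\<mu> * \<gamma>max)" using L \<mu> \<gamma>max by (simp add: field_simps)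
    then show ?thesis using True \<mu> by (simp add: m_def \<kappa>'_def field_simps)
  next
    case False
    then have "1 / (\<mu> * \<gamma>max) \<le> L / \<mu>" using L \<mu> \<gamma>max by (simp add: field_simps)
    then show ?thesis using False \<mu> by (simp add: m_def \<kappa>'_def field_simps)
  qed
  have m: "0 < m" "m \<le> \<gamma>max" using L \<gamma>max by (auto simp: m_def)
  have \<gamma>err: "\<gamma>err = \<gamma>max - m" by (simp add: \<gamma>err_def m_def)
  have \<kappa>': "0 < \<kappa>'" using L \<mu> unfolding \<kappa>'_def by (simp add: less_max_iff_disj)
  have \<sigma>2: "\<sigma>2 = (\<Sum>i=1..n. s i) / real n" by (simp add: \<sigma>2_def s_def)
  have "0 \<le> \<sigma>2"
    unfolding \<sigma>2 s_def using bounded_below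
    by (intro divide_nonneg_nonneg sum_nonneg) (auto intro!: cINF_lower)
  then have pq: "0 \<le> p" "0 \<le> q" using \<gamma>max m by (auto simp: p_def q_def \<gamma>err)
  have \<alpha>: "0 < \<alpha>" "\<alpha> \<le> 1"
    using \<beta> T unfolding \<alpha>_def by (auto intro!: powr_le1)
  have \<alpha>s: "\<alpha>s k = \<alpha> ^ k" for k
    using \<alpha>(1) unfolding \<alpha>s_def by (simp add: powr_powr \<alpha>_def flip: powr_realpow)

  have rv: "\<And>k. k \<in> {1..T} \<Longrightarrow> random_variable (count_space {1..n}) (idx k)"
    using indep by (auto simp: indep_vars_def)
  have adapted: "\<exists>g. \<forall>\<omega>\<in>space M. w k \<omega> = g (restrict (\<lambda>j. idx j \<omega>) {1..<k})"
    if "1 \<le> k" "k \<le> T + 1" for k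
  proof -
    \<comment> \<open>The line search as a function of the iterate and the index; any step size serves where no
      largest one exists, since the iteration never visits such a point.\<close>
    define G where "G k i x = x - ((SOME \<eta>. largest_armijo_step (1 / 2) \<gamma>max (f i) x \<eta>) * \<alpha>s k)
        *\<^sub>R gradient (f i) x" for k i x
    have "w (k + 1) \<omega> = G k (idx k \<omega>) (w k \<omega>)" if k: "k \<in> {1..T}" and \<omega>: "\<omega> \<in> space M" for k \<omega>
    proof -
      have "\<gamma> k \<omega> = (SOME \<eta>. largest_armijo_step (1 / 2) \<gamma>max (f (idx k \<omega>)) (w k \<omega>) \<eta>)"
        by (intro largest_armijo_step_unique[OF step_size[OF k \<omega>]]
            someI[of "largest_armijo_step (1 / 2) \<gamma>max (f (idx k \<omega>)) (w k \<omega>)", OF step_size[OF k \<omega>]])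
      then show ?thesis
        using sgd[OF k \<omega>] by (simp add: G_def)
    qed
    then show ?thesis
      using start that
      by (intro adapted_recursion[where \<Omega> = "space M" and X = idx and Y = w and G = G
            and T = T and ?y1.0 = w1]) auto
  qed
  have int: "integrable M (\<lambda>\<omega>. \<phi> (w k \<omega>))"
    if k: "1 \<le> k" "k \<le> T + 1" for k and \<phi> :: "real ^ 'd \<Rightarrow> real"
  proof -
    obtain g where g: "\<forall>\<omega>\<in>space M. w k \<omega> = g (restrict (\<lambda>j. idx j \<omega>) {1..<k})"
      using adapted[OF k] by blast
    have "integrable M (\<lambda>\<omega>. \<phi> (g (restrict (\<lambda>j. idx j \<omega>) {1..<k})))"
      using k by (intro integrable_of_finite_family[where A = "{1..n}" and \<phi> = "\<lambda>s. \<phi> (g s)"] rv) auto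
    then show ?thesis using g by (subst Bochner_Integration.integrable_cong) auto
  qed

  have step: "e (k + 1) \<le> (1 - \<alpha> ^ k / \<kappa>') * e k + (p * (\<alpha> ^ k)\<^sup>2 + q * \<alpha> ^ k)"
    if k: "k \<in> {1..T}" for k
  proof -
    define a where "a = \<alpha> ^ k"
    have a: "0 \<le> a" "a \<le> 1" using \<alpha> by (auto simp: a_def power_le_one)
    define H where "H i x = (norm (x - wstar))\<^sup>2
        - 2 * m * a * (gradient (f i) x \<bullet> (x - wstar) - a * (f i x - f i wstar))
        + (2 * \<gamma>max * a\<^sup>2 + 2 * (\<gamma>max - m) * a) * s i" for i x
    obtain g where g: "\<And>\<omega>. \<omega> \<in> space M \<Longrightarrow> w k \<omega> = g (restrict (\<lambda>j. idx j \<omega>) {1..<k})"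
      using adapted[of k] k by auto
    have past: "{1..<k} \<subseteq> {1..T}" using k by auto
    have fresh: "integrable M (\<lambda>\<omega>. H (idx k \<omega>) (w k \<omega>))"
      "expectation (\<lambda>\<omega>. H (idx k \<omega>) (w k \<omega>)) = expectation (\<lambda>\<omega>. (\<Sum>i=1..n. H i (w k \<omega>)) / real n)"
      using expectation_fresh_uniform_index[OF indep _ _ past k _ uniform[OF k],
          where Y = "w k" and g = g and H = H] g
      by simp_all
    have pathwise: "(norm (w (k + 1) \<omega> - wstar))\<^sup>2 \<le> H (idx k \<omega>) (w k \<omega>)"
      if \<omega>: "\<omega> \<in> space M" for \<omega>
    proof -
      have i: "idx k \<omega> \<in> {1..n}" using measurable_space[OF rv[OF k] \<omega>] by simp
      show ?thesis
        unfolding sgd[OF k \<omega>] \<alpha>s H_def s_def m_def a_def[symmetric]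
        by (intro armijo_step_distance differentiable bounded_below convex smooth_L L step_size a i k \<omega>)
    qed
    have averaged: "(\<Sum>i=1..n. H i x) / real n \<le> (1 - a / \<kappa>') * (norm (x - wstar))\<^sup>2 + (p * a\<^sup>2 + q * a)" for x
    proof -
      define d where "d i = gradient (f i) x \<bullet> (x - wstar) - a * (f i x - f i wstar)" for i
      have "(\<Sum>i=1..n. H i x) / real n = (norm (x - wstar))\<^sup>2 - 2 * m * a * ((\<Sum>i=1..n. d i) / real n)
          + (2 * \<gamma>max * a\<^sup>2 + 2 * (\<gamma>max - m) * a) * \<sigma>2"
        unfolding H_def \<sigma>2 d_def[symmetric] using n
        by (simp add: sum.distrib sum_subtractf add_divide_distrib diff_divide_distrib flip: sum_distrib_left)
      also have "\<dots> \<le> (norm (x - wstar))\<^sup>2 - 2 * m * a * (\<mu> / 2 * (norm (x - wstar))\<^sup>2)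
          + (2 * \<gamma>max * a\<^sup>2 + 2 * (\<gamma>max - m) * a) * \<sigma>2"
      proof -
        have "\<mu> / 2 * (norm (x - wstar))\<^sup>2 \<le> (\<Sum>i=1..n. d i) / real n"
          unfolding d_def
          by (intro average_descent differentiable strongly_convex[unfolded F_def] minimizer[unfolded F_def] a)
        moreover have "0 \<le> 2 * m * a" using a m by simp
        ultimately show ?thesis by (intro add_right_mono diff_left_mono mult_left_mono)
      qed
      also have "\<dots> = (1 - a * (m * \<mu>)) * (norm (x - wstar))\<^sup>2 + (p * a\<^sup>2 + q * a)"
        by (simp add: p_def q_def \<gamma>err algebra_simps)
      finally show ?thesis by (simp add: contraction)
    qed
    have "e (k + 1) \<le> expectation (\<lambda>\<omega>. H (idx k \<omega>) (w k \<omega>))"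
      unfolding e_def using k pathwise
      by (intro integral_mono int[of "k + 1" "\<lambda>x. (norm (x - wstar))\<^sup>2"] fresh(1)) auto
    also have "\<dots> \<le> expectation (\<lambda>\<omega>. (1 - a / \<kappa>') * (norm (w k \<omega> - wstar))\<^sup>2 + (p * a\<^sup>2 + q * a))"
      unfolding fresh(2) using k averaged
      by (intro integral_mono int[of k "\<lambda>x. (\<Sum>i=1..n. H i x) / real n"]
          int[of k "\<lambda>x. (1 - a / \<kappa>') * (norm (x - wstar))\<^sup>2 + (p * a\<^sup>2 + q * a)"]) auto
    also have "\<dots> = (1 - a / \<kappa>') * e k + (p * a\<^sup>2 + q * a)"
      unfolding e_def using int[of k "\<lambda>x. (norm (x - wstar))\<^sup>2"] k
      by (simp add: prob_space)
    finally show ?thesis by (simp add: a_def)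
  qed

  have "e 1 = (norm (w1 - wstar))\<^sup>2"
  proof -
    have "e 1 = expectation (\<lambda>\<omega>. (norm (w1 - wstar))\<^sup>2)"
      unfolding e_def using start by (intro Bochner_Integration.integral_cong) auto
    then show ?thesis by (simp add: prob_space)
  qed
  then have "e (T + 1) \<le> (norm (w1 - wstar))\<^sup>2 * exp (- (\<Sum>i=1..T. \<alpha> ^ i / \<kappa>'))
      + (\<Sum>k=1..T. (p * (\<alpha> ^ k)\<^sup>2 + q * \<alpha> ^ k) * exp (- (\<Sum>i=k+1..T. \<alpha> ^ i / \<kappa>')))"
    using unroll_contraction[where e = e and a = "\<lambda>i. \<alpha> ^ i / \<kappa>'", OF step] by (simp add: e_def)
  also have "\<dots> \<le> (norm (w1 - wstar))\<^sup>2 * (c1 * exp (- (real T / \<kappa>') * (\<alpha> / ln (real T / \<beta>))))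
        + (4 * p * c1 * \<kappa>'\<^sup>2 / (exp 1)\<^sup>2 * ((ln (real T / \<beta>))\<^sup>2 / (\<alpha>\<^sup>2 * real T))
          + q * c1 * \<kappa>' * ln (real T / \<beta>) / (exp 1 * \<alpha>))"
    unfolding \<alpha>_def c1_def using \<beta> \<kappa>' pq
    by (intro add_mono mult_left_mono exponential_schedule_sums) auto
  finally show ?thesis
    by (simp add: e_def p_def q_def mult_ac)
qed

end
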